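(* Let $\theta$ be a stationary function of $\mathcal E$ with free boundaries such that $V_\theta(\theta(a))\neq0$ and $V_\theta(\theta(b))\neq0$. Define $\beta=\xi(a)-\xi(b)$, where $\xi(s)=\theta'(s)\,V_\theta(\theta(s))$. If $\beta\le0$, then $\theta$ is not locally minimal for $\mathcal E$ on $\mathcal C^N([a,b])$.
   Context: Let $a<b$ be real numbers, $A\in\mathbb R$, and let $V:\mathbb R\to\mathbb R$ be of class $C^2$ such that $V_\theta=dV/d\theta$ and $V_{\theta\theta}=d^2V/d\theta^2$ have no common zero. For $\theta\in C^1([a,b])$ set $\mathcal E[\theta]=\int_a^b\left(\frac{(\theta'(s)-A)^2}{2}-V(\theta(s))\right)ds$. Free boundaries: no values of $\theta$ are prescribed at $a,b$. Let $\mathcal C^N([a,b])=\{\tau\in C^1([a,b]):\tau'(a)=\tau'(b)=0\}\setminus\{0\}$. $\theta$ is stationary if $\frac{d}{d\epsilon}\mathcal E[\theta+\epsilon\tau]|_{\epsilon=0}=0$ for all $\tau\in\mathcal C^N([a,b])$; equivalently, $\theta$ is a $C^2$ solution of $\theta''(s)+V_\theta(\theta(s))=0$ on $[a,b]$ with $\theta'(a)=\theta'(b)=A$. $\theta$ is locally minimal for $\mathcal E$ on a set $\mathcal P$ of perturbations if for every $\tau\in\mathcal P$ there exists $M>0$ such that $\mathcal E[\theta+\epsilon\tau]>\mathcal E[\theta]$ for all $\epsilon\in[-M,M]\setminus\{0\}$. *)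

theory Defs
  imports "HOL-Analysis.Analysis"
begin

(* Functions on [a,b] are represented by total functions real => real whose values outside
   [a,b] are irrelevant: derivatives are taken within {a..b}, hence one-sided at a and b. *)

definition deriv_on :: "real \<Rightarrow> real \<Rightarrow> (real \<Rightarrow> real) \<Rightarrow> real \<Rightarrow> real" where
  "deriv_on a b f s = vector_derivative f (at s within {a..b})"

(* The library predicate C1_differentiable_on uses two-sided derivatives, also at a and b,
   and would thus constrain f outside [a,b]. *)
definition C1_interval :: "real \<Rightarrow> real \<Rightarrow> (real \<Rightarrow> real) \<Rightarrow> bool" where
  "C1_interval a b f \<longleftrightarrow>
     f differentiable_on {a..b} \<and> continuous_on {a..b} (deriv_on a b f)"

definition C2_real :: "(real \<Rightarrow> real) \<Rightarrow> bool" where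
  "C2_real V \<longleftrightarrow> V C1_differentiable_on UNIV \<and> deriv V C1_differentiable_on UNIV"

definition energy :: "real \<Rightarrow> real \<Rightarrow> real \<Rightarrow> (real \<Rightarrow> real) \<Rightarrow> (real \<Rightarrow> real) \<Rightarrow> real" where
  "energy a b A V \<theta> = integral {a..b} (\<lambda>s. (deriv_on a b \<theta> s - A)\<^sup>2 / 2 - V (\<theta> s))"

definition free_perturbations :: "real \<Rightarrow> real \<Rightarrow> (real \<Rightarrow> real) set" where
  "free_perturbations a b =
     {\<tau>. C1_interval a b \<tau> \<and> deriv_on a b \<tau> a = 0 \<and> deriv_on a b \<tau> b = 0 \<and>
         (\<exists>s\<in>{a..b}. \<tau> s \<noteq> 0)}"

definition free_stationary :: "real \<Rightarrow> real \<Rightarrow> real \<Rightarrow> (real \<Rightarrow> real) \<Rightarrow> (real \<Rightarrow> real) \<Rightarrow> bool" where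
  "free_stationary a b A V \<theta> \<longleftrightarrow>
     C1_interval a b \<theta> \<and>
     (\<forall>\<tau>\<in>free_perturbations a b.
        ((\<lambda>\<epsilon>. energy a b A V (\<lambda>s. \<theta> s + \<epsilon> * \<tau> s)) has_real_derivative 0) (at 0))"

definition locally_minimal ::
  "real \<Rightarrow> real \<Rightarrow> real \<Rightarrow> (real \<Rightarrow> real) \<Rightarrow> (real \<Rightarrow> real) set \<Rightarrow> (real \<Rightarrow> real) \<Rightarrow> bool" where
  "locally_minimal a b A V P \<theta> \<longleftrightarrow>
     (\<forall>\<tau>\<in>P. \<exists>M>0. \<forall>\<epsilon>\<in>{-M..M} - {0}.
        energy a b A V (\<lambda>s. \<theta> s + \<epsilon> * \<tau> s) > energy a b A V \<theta>)"

definition xi :: "real \<Rightarrow> real \<Rightarrow> (real \<Rightarrow> real) \<Rightarrow> (real \<Rightarrow> real) \<Rightarrow> real \<Rightarrow> real" where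
  "xi a b V \<theta> s = deriv_on a b \<theta> s * deriv V (\<theta> s)"

end

theory Submission
  imports Defs
begin

text \<open>
  Along a line \<open>\<theta> + \<epsilon> \<tau>\<close> the energy is, up to \<open>o(\<epsilon>\<^sup>2)\<close>, equal to
  \<open>E[\<theta>] + \<epsilon> L(\<tau>) + (\<epsilon>\<^sup>2 / 2) Q(\<tau>)\<close>, where \<open>L\<close> is the first variation and
  \<open>Q(\<tau>) = \<integral> \<tau>'\<^sup>2 - V''(\<theta>) \<tau>\<^sup>2\<close> the second one (lemma \<open>energy_expansion\<close>). As \<open>L\<close> vanishes on the
  admissible perturbations of a stationary function, it suffices to find an admissible \<open>\<tau>\<close> with
  \<open>Q(\<tau>) < 0\<close>.

  A stationary \<open>\<theta>\<close> satisfies \<open>\<theta>'' = - V'(\<theta>)\<close> (lemma \<open>free_stationary_euler_lagrange\<close>),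
  so the translation mode \<open>\<phi> = \<theta>'\<close> solves the Jacobi equation \<open>\<phi>'' + V''(\<theta>) \<phi> = 0\<close>, and
  integration by parts gives \<open>Q(\<phi>) = \<phi>(b) \<phi>'(b) - \<phi>(a) \<phi>'(a) = \<xi>(a) - \<xi>(b) = \<beta>\<close>. However,
  \<open>\<phi>' = - V'(\<theta>)\<close> does not vanish at the end points, so \<open>\<phi>\<close> is not admissible. This is
  mended by a correction \<open>\<eta>\<close> with \<open>\<eta>' = V'(\<theta>)\<close> at \<open>a\<close> and \<open>b\<close>. Integrating by parts again,
  \<open>Q(\<phi> + \<eta>) = \<beta> - 2 (V'(\<theta>(b)) \<eta>(b) - V'(\<theta>(a)) \<eta>(a)) + Q(\<eta>)\<close>
  (lemma \<open>jacobi_second_variation_add\<close>). If \<open>\<eta>\<close> lives in boundary layers of width \<open>1/n\<close>, both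
  terms in \<open>\<eta>\<close> are of order \<open>1/n\<close>, and for a suitable profile the boundary term prevails for large
  \<open>n\<close> (lemma \<open>second_variation_end_correction\<close>): correcting the end slopes strictly lowers the
  second variation. Hence \<open>Q(\<phi> + \<eta>) < \<beta> \<le> 0\<close>.
\<close>

section \<open>Continuously differentiable functions\<close>

lemma deriv_on_eqI:
  assumes "a < b" "s \<in> {a..b}" "(f has_real_derivative d) (at s within {a..b})"
  shows "deriv_on a b f s = d"
  unfolding deriv_on_def
  using assms vector_derivative_within_closed_interval[of a b s f d]
  by (auto simp: has_real_derivative_iff_has_vector_derivative)

lemma C1_interval_has_derivative:
  assumes "C1_interval a b f" "s \<in> {a..b}"
  shows "(f has_real_derivative deriv_on a b f s) (at s within {a..b})"
  using assms unfolding C1_interval_def deriv_on_def differentiable_on_def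
  by (auto simp: has_real_derivative_iff_has_vector_derivative vector_derivative_works)

lemma C1_interval_continuous:
  assumes "C1_interval a b f"
  shows "continuous_on {a..b} f" "continuous_on {a..b} (deriv_on a b f)"
  using assms unfolding C1_interval_def
  by (auto intro: differentiable_imp_continuous_on)

lemma continuous_on_interval_bounded:
  fixes f :: "real \<Rightarrow> real"
  assumes "continuous_on {a..b} f"
  obtains K where "\<And>s. s \<in> {a..b} \<Longrightarrow> \<bar>f s\<bar> \<le> K"
proof -
  have "bounded (f ` {a..b})"
    by (rule compact_imp_bounded[OF compact_continuous_image[OF assms compact_Icc]])
  then obtain K where "\<forall>y\<in>f ` {a..b}. norm y \<le> K" unfolding bounded_iff by blast
  then have "\<bar>f s\<bar> \<le> K" if "s \<in> {a..b}" for s using that by simp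
  then show thesis by (rule that)
qed

lemma C1_intervalI:
  assumes "a < b" "\<And>s. s \<in> {a..b} \<Longrightarrow> (f has_real_derivative f' s) (at s within {a..b})"
    "continuous_on {a..b} f'"
  shows "C1_interval a b f"
proof -
  have "continuous_on {a..b} (deriv_on a b f)"
    by (rule continuous_on_eq[OF assms(3)]) (use assms deriv_on_eqI in force)
  moreover have "f differentiable_on {a..b}"
    using assms(2) unfolding differentiable_on_def real_differentiable_def by blast
  ultimately show ?thesis unfolding C1_interval_def by blast
qed

lemma C2_real_derivs:
  assumes "C2_real V"
  shows "(V has_real_derivative deriv V x) (at x)"
    "(deriv V has_real_derivative deriv (deriv V) x) (at x)"
    "continuous_on S V" "continuous_on S (deriv V)" "continuous_on S (deriv (deriv V))"
proof -
  have C1: "(f has_real_derivative deriv f x) (at x) \<and> continuous_on UNIV (deriv f)"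
    if f: "f C1_differentiable_on UNIV" for f :: "real \<Rightarrow> real" and x
  proof -
    obtain D where D: "\<forall>x. (f has_vector_derivative D x) (at x)" "continuous_on UNIV D"
      using f unfolding C1_differentiable_on_def by blast
    then have D': "(f has_real_derivative D x) (at x)" for x
      by (simp add: has_real_derivative_iff_has_vector_derivative)
    then have "deriv f = D" by (auto intro: DERIV_imp_deriv)
    with D' D(2) show ?thesis by simp
  qed
  have d1: "(V has_real_derivative deriv V x) (at x)" for x
    using C1 assms unfolding C2_real_def by blast
  have d2: "(deriv V has_real_derivative deriv (deriv V) x) (at x)" for x
    using C1 assms unfolding C2_real_def by blast
  show "(V has_real_derivative deriv V x) (at x)"
    "(deriv V has_real_derivative deriv (deriv V) x) (at x)" using d1 d2 by auto
  show "continuous_on S V" "continuous_on S (deriv V)"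
    using d1 d2 by (auto intro!: DERIV_continuous_on intro: DERIV_subset)
  show "continuous_on S (deriv (deriv V))"
    using C1 assms continuous_on_subset unfolding C2_real_def by blast
qed

text \<open>
  The remainder is uniform for base points in a compact set, because \<open>V''\<close> is uniformly continuous
  there; this allows integration of the expansion along \<open>\<theta>\<close>.
\<close>

lemma C2_real_uniform_taylor:
  assumes "C2_real V" "e > 0"
  obtains d where "d > 0"
    "\<And>x h. \<bar>x\<bar> \<le> K \<Longrightarrow> \<bar>h\<bar> < d \<Longrightarrow>
       \<bar>V (x + h) - V x - deriv V x * h - deriv (deriv V) x * h\<^sup>2 / 2\<bar> \<le> e * h\<^sup>2"
proof -
  note V = C2_real_derivs[OF assms(1)]
  \<comment> \<open>The margin \<open>1\<close> makes room for the intermediate points between \<open>x\<close> and \<open>x + h\<close>.\<close>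
  have "uniformly_continuous_on {-K-1..K+1} (deriv (deriv V))"
    by (intro compact_uniformly_continuous V) simp
  then obtain d where d: "d > 0"
    "\<And>x y. x \<in> {-K-1..K+1} \<Longrightarrow> y \<in> {-K-1..K+1} \<Longrightarrow> dist y x < d \<Longrightarrow>
       dist (deriv (deriv V) y) (deriv (deriv V) x) < e"
    using assms(2) unfolding uniformly_continuous_on_def by metis
  show thesis
  proof
    show "min d 1 > 0" using d by simp
    fix x h :: real
    assume x: "\<bar>x\<bar> \<le> K" and h: "\<bar>h\<bar> < min d 1"
    show "\<bar>V (x + h) - V x - deriv V x * h - deriv (deriv V) x * h\<^sup>2 / 2\<bar> \<le> e * h\<^sup>2"
    proof (cases "h = 0")
      case False
      \<comment> \<open>Lagrange form of the remainder: the second derivative is taken at an intermediate point.\<close>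
      define diff where "diff m = (if m = 0 then V else if m = 1 then deriv V
          else deriv (deriv V))" for m :: nat
      have "\<forall>m t. m < 2 \<and> x - \<bar>h\<bar> \<le> t \<and> t \<le> x + \<bar>h\<bar> \<longrightarrow> DERIV (diff m) t :> diff (Suc m) t"
        using V(1,2) by (auto simp: diff_def less_2_cases_iff)
      moreover have "x - \<bar>h\<bar> \<le> x + h" "x + h \<le> x + \<bar>h\<bar>" by linarith+
      ultimately have "\<exists>t. (if x + h < x then x + h < t \<and> t < x else x < t \<and> t < x + h) \<and>
          V (x + h) = (\<Sum>m<2. diff m x / fact m * (x + h - x) ^ m)
            + diff 2 t / fact 2 * (x + h - x) ^ 2"
        using False by (intro Taylor[where a = "x - \<bar>h\<bar>" and b = "x + \<bar>h\<bar>"])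
          (auto simp: diff_def)
      then obtain t where t: "if x + h < x then x + h < t \<and> t < x else x < t \<and> t < x + h"
        "V (x + h) = (\<Sum>m<2. diff m x / fact m * h ^ m) + diff 2 t / fact 2 * h ^ 2"
        by (simp only: add_diff_cancel_left') blast
      have "dist (deriv (deriv V) t) (deriv (deriv V) x) < e"
        by (rule d(2)) (use t(1) x h in \<open>auto simp: dist_real_def split: if_splits\<close>)
      then have "\<bar>deriv (deriv V) t - deriv (deriv V) x\<bar> / 2 \<le> e"
        using assms(2) by (auto simp: dist_real_def)
      then have "\<bar>deriv (deriv V) t - deriv (deriv V) x\<bar> / 2 * h\<^sup>2 \<le> e * h\<^sup>2"
        by (rule mult_right_mono) simp
      moreover have "V (x + h) - V x - deriv V x * h - deriv (deriv V) x * h\<^sup>2 / 2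
          = (deriv (deriv V) t - deriv (deriv V) x) / 2 * h\<^sup>2"
        unfolding t(2) by (simp add: diff_def numeral_2_eq_2 field_simps)
      ultimately show ?thesis by (simp only: abs_mult abs_divide abs_numeral abs_power2)
    qed simp
  qed
qed

section \<open>First and second variation of the energy\<close>

text \<open>
  Both variations are given by their integral formulas; lemma \<open>energy_expansion\<close> below shows that
  they give the second-order Taylor expansion of the energy along \<open>\<theta> + \<epsilon> \<tau>\<close>.
\<close>

definition first_variation ::
  "real \<Rightarrow> real \<Rightarrow> real \<Rightarrow> (real \<Rightarrow> real) \<Rightarrow> (real \<Rightarrow> real) \<Rightarrow> (real \<Rightarrow> real) \<Rightarrow> real" where
  "first_variation a b A V \<theta> \<tau> =
     integral {a..b} (\<lambda>s. (deriv_on a b \<theta> s - A) * deriv_on a b \<tau> s - deriv V (\<theta> s) * \<tau> s)"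

text \<open>The Taylor factor \<open>1/2\<close> is not included: the form is twice the coefficient of \<open>\<epsilon>\<^sup>2\<close>.\<close>

definition second_variation ::
  "real \<Rightarrow> real \<Rightarrow> (real \<Rightarrow> real) \<Rightarrow> (real \<Rightarrow> real) \<Rightarrow> (real \<Rightarrow> real) \<Rightarrow> real" where
  "second_variation a b V \<theta> \<tau> =
     integral {a..b} (\<lambda>s. (deriv_on a b \<tau> s)\<^sup>2 - deriv (deriv V) (\<theta> s) * (\<tau> s)\<^sup>2)"

lemma deriv_on_add_scaled:
  assumes "a < b" "C1_interval a b \<theta>" "C1_interval a b \<tau>" "s \<in> {a..b}"
  shows "deriv_on a b (\<lambda>s. \<theta> s + \<epsilon> * \<tau> s) s = deriv_on a b \<theta> s + \<epsilon> * deriv_on a b \<tau> s"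
  using assms
  by (intro deriv_on_eqI) (auto intro!: derivative_eq_intros C1_interval_has_derivative)

lemma energy_expansion:
  assumes "a < b" "C2_real V" "C1_interval a b \<theta>" "C1_interval a b \<tau>" "e > 0"
  obtains d where "d > 0"
    "\<And>\<epsilon>. \<bar>\<epsilon>\<bar> < d \<Longrightarrow>
       \<bar>energy a b A V (\<lambda>s. \<theta> s + \<epsilon> * \<tau> s) - energy a b A V \<theta>
        - \<epsilon> * first_variation a b A V \<theta> \<tau> - \<epsilon>\<^sup>2 / 2 * second_variation a b V \<theta> \<tau>\<bar> \<le> e * \<epsilon>\<^sup>2"
proof -
  note V = C2_real_derivs[OF assms(2)]
  note [continuous_intros] = C1_interval_continuous[OF assms(3)] C1_interval_continuous[OF assms(4)]
  have comp: "continuous_on {a..b} (\<lambda>s. F (f s))"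
    if "\<And>S. continuous_on S F" "continuous_on {a..b} f" for F f :: "real \<Rightarrow> real"
    using that continuous_on_compose2 by blast
  note [continuous_intros] = comp[OF V(3)] comp[OF V(4)] comp[OF V(5)]
  obtain K where K: "\<And>s. s \<in> {a..b} \<Longrightarrow> \<bar>\<theta> s\<bar> \<le> K"
    using continuous_on_interval_bounded[OF C1_interval_continuous(1)[OF assms(3)]] by blast
  obtain T0 where T0: "\<And>s. s \<in> {a..b} \<Longrightarrow> \<bar>\<tau> s\<bar> \<le> T0"
    using continuous_on_interval_bounded[OF C1_interval_continuous(1)[OF assms(4)]] by blast
  define T where "T = max T0 1"
  have T: "T > 0" "\<And>s. s \<in> {a..b} \<Longrightarrow> \<bar>\<tau> s\<bar> \<le> T"
    using T0 by (auto simp: T_def le_max_iff_disj)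
  define e' where "e' = e / (T\<^sup>2 * (b - a))"
  have e': "e' > 0" using assms T by (simp add: e'_def)
  obtain d where d: "d > 0"
    "\<And>x h. \<bar>x\<bar> \<le> K \<Longrightarrow> \<bar>h\<bar> < d \<Longrightarrow>
       \<bar>V (x + h) - V x - deriv V x * h - deriv (deriv V) x * h\<^sup>2 / 2\<bar> \<le> e' * h\<^sup>2"
    using C2_real_uniform_taylor[OF assms(2) e'] by metis
  show thesis
  proof
    show "d / T > 0" using d T by simp
    fix \<epsilon> :: real assume \<epsilon>: "\<bar>\<epsilon>\<bar> < d / T"
    define R where "R s = V (\<theta> s + \<epsilon> * \<tau> s) - V (\<theta> s) - deriv V (\<theta> s) * (\<epsilon> * \<tau> s)
      - deriv (deriv V) (\<theta> s) * (\<epsilon> * \<tau> s)\<^sup>2 / 2" for s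
    have Rc: "continuous_on {a..b} R"
      unfolding R_def by (intro continuous_intros) auto
    have Rb: "norm (R s) \<le> e' * (\<epsilon>\<^sup>2 * T\<^sup>2)" if s: "s \<in> {a..b}" for s
    proof -
      have "\<bar>\<epsilon> * \<tau> s\<bar> \<le> \<bar>\<epsilon>\<bar> * T"
        using T(2)[OF s] by (simp add: abs_mult mult_left_mono)
      moreover have "\<bar>\<epsilon>\<bar> * T < d" using \<epsilon> T by (simp add: field_simps)
      ultimately have "\<bar>\<epsilon> * \<tau> s\<bar> < d" by simp
      from d(2)[OF K[OF s] this] have "norm (R s) \<le> e' * (\<epsilon> * \<tau> s)\<^sup>2"
        by (simp add: R_def)
      also have "(\<epsilon> * \<tau> s)\<^sup>2 \<le> \<epsilon>\<^sup>2 * T\<^sup>2"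
        using T(2)[OF s] by (auto simp: power_mult_distrib intro!: mult_left_mono power2_le_iff_abs_le[THEN iffD2])
      finally show ?thesis using e' by simp
    qed
    have "norm (integral {a..b} R) \<le> e' * (\<epsilon>\<^sup>2 * T\<^sup>2) * (b - a)"
      by (intro integral_bound Rc Rb) (use assms in auto)
    also have "\<dots> = e * \<epsilon>\<^sup>2" using T assms by (simp add: e'_def)
    finally have bd: "\<bar>integral {a..b} R\<bar> \<le> e * \<epsilon>\<^sup>2" by simp
    have "energy a b A V (\<lambda>s. \<theta> s + \<epsilon> * \<tau> s) =
        integral {a..b} (\<lambda>s. (deriv_on a b \<theta> s + \<epsilon> * deriv_on a b \<tau> s - A)\<^sup>2 / 2 - V (\<theta> s + \<epsilon> * \<tau> s))"
      unfolding energy_def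
      by (rule integral_cong) (use assms deriv_on_add_scaled in auto)
    also have "\<dots> = integral {a..b} (\<lambda>s.
        ((deriv_on a b \<theta> s - A)\<^sup>2 / 2 - V (\<theta> s))
        + \<epsilon> * ((deriv_on a b \<theta> s - A) * deriv_on a b \<tau> s - deriv V (\<theta> s) * \<tau> s)
        + \<epsilon>\<^sup>2 / 2 * ((deriv_on a b \<tau> s)\<^sup>2 - deriv (deriv V) (\<theta> s) * (\<tau> s)\<^sup>2) - R s)"
      by (rule integral_cong) (simp add: R_def power2_eq_square field_simps)
    also have "\<dots> = energy a b A V \<theta> + \<epsilon> * first_variation a b A V \<theta> \<tau>
        + \<epsilon>\<^sup>2 / 2 * second_variation a b V \<theta> \<tau> - integral {a..b} R"
      unfolding energy_def first_variation_def second_variation_def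
      by (intro integral_unique has_integral_diff has_integral_add has_integral_mult_right
          integrable_integral integrable_continuous_interval continuous_intros Rc) auto
    finally show "\<bar>energy a b A V (\<lambda>s. \<theta> s + \<epsilon> * \<tau> s) - energy a b A V \<theta>
        - \<epsilon> * first_variation a b A V \<theta> \<tau> - \<epsilon>\<^sup>2 / 2 * second_variation a b V \<theta> \<tau>\<bar> \<le> e * \<epsilon>\<^sup>2"
      using bd by simp
  qed
qed

lemma free_stationary_first_variation:
  assumes "a < b" "C2_real V" "free_stationary a b A V \<theta>" "\<tau> \<in> free_perturbations a b"
  shows "first_variation a b A V \<theta> \<tau> = 0"
proof -
  have C1: "C1_interval a b \<theta>" "C1_interval a b \<tau>"
    using assms unfolding free_stationary_def free_perturbations_def by auto
  let ?E = "\<lambda>\<epsilon>. energy a b A V (\<lambda>s. \<theta> s + \<epsilon> * \<tau> s)"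
  let ?L = "first_variation a b A V \<theta> \<tau>" and ?Q = "second_variation a b V \<theta> \<tau>"
  obtain d where d: "d > 0"
    "\<And>\<epsilon>. \<bar>\<epsilon>\<bar> < d \<Longrightarrow> \<bar>?E \<epsilon> - energy a b A V \<theta> - \<epsilon> * ?L - \<epsilon>\<^sup>2 / 2 * ?Q\<bar> \<le> 1 * \<epsilon>\<^sup>2"
    using energy_expansion[OF assms(1,2) C1, of 1] by auto
  define C where "C = 1 + \<bar>?Q\<bar> / 2"
  have bd: "\<bar>(?E \<epsilon> - ?E 0) / \<epsilon> - ?L\<bar> \<le> C * \<bar>\<epsilon>\<bar>" if "\<bar>\<epsilon>\<bar> < d" "\<epsilon> \<noteq> 0" for \<epsilon>
  proof -
    have "\<bar>?E \<epsilon> - ?E 0 - \<epsilon> * ?L\<bar> \<le> \<epsilon>\<^sup>2 + \<bar>\<epsilon>\<^sup>2 / 2 * ?Q\<bar>"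
      using d(2)[OF that(1)] by simp
    also have "\<dots> = C * \<bar>\<epsilon>\<bar> * \<bar>\<epsilon>\<bar>"
      by (simp add: C_def abs_mult power2_eq_square field_simps)
    finally have "\<bar>?E \<epsilon> - ?E 0 - \<epsilon> * ?L\<bar> / \<bar>\<epsilon>\<bar> \<le> C * \<bar>\<epsilon>\<bar>"
      using that by (simp add: pos_divide_le_eq)
    moreover have "(?E \<epsilon> - ?E 0) / \<epsilon> - ?L = (?E \<epsilon> - ?E 0 - \<epsilon> * ?L) / \<epsilon>"
      using that by (simp add: field_simps)
    ultimately show ?thesis by (simp only: abs_divide)
  qed
  have "((\<lambda>\<epsilon>. (?E \<epsilon> - ?E 0) / \<epsilon> - ?L) \<longlongrightarrow> 0) (at 0)"
  proof (rule Lim_null_comparison)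
    show "\<forall>\<^sub>F \<epsilon> in at 0. norm ((?E \<epsilon> - ?E 0) / \<epsilon> - ?L) \<le> C * \<bar>\<epsilon>\<bar>"
      unfolding eventually_at using d(1) bd by (intro exI[of _ d]) (auto simp: dist_real_def)
    show "((\<lambda>\<epsilon>. C * \<bar>\<epsilon>\<bar>) \<longlongrightarrow> 0) (at 0)"
      by (auto intro!: tendsto_eq_intros)
  qed
  then have "(?E has_real_derivative ?L) (at 0)"
    unfolding DERIV_def by (subst LIM_zero_iff[symmetric]) simp
  moreover have "(?E has_real_derivative 0) (at 0)"
    using assms unfolding free_stationary_def by blast
  ultimately show ?thesis using DERIV_unique by blast
qed

section \<open>The Euler-Lagrange equation\<close>

text \<open>
  The du Bois-Reymond lemma with test functions \<open>h\<close> that vanish at both end points. The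
  classical choice \<open>h = p - c\<close> need not vanish there, so it
  is multiplied by the weight \<open>w(s) = (s - a) (b - s)\<close>, and \<open>c\<close> is the \<open>w\<close>-weighted mean of \<open>p\<close>.
\<close>

lemma du_Bois_Reymond_vanishing_ends:
  fixes p :: "real \<Rightarrow> real"
  assumes "a < b" and p: "continuous_on {a..b} p"
    and orth: "\<And>h. continuous_on {a..b} h \<Longrightarrow> h a = 0 \<Longrightarrow> h b = 0 \<Longrightarrow> integral {a..b} h = 0 \<Longrightarrow>
      integral {a..b} (\<lambda>s. p s * h s) = 0"
  obtains c where "\<And>s. s \<in> {a..b} \<Longrightarrow> p s = c"
proof -
  define w where "w s = (s - a) * (b - s)" for s
  have w: "continuous_on {a..b} w" unfolding w_def by (intro continuous_intros)
  note [continuous_intros] = p w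
  have int0: "integral {a..b} w \<noteq> 0"
  proof
    assume "integral {a..b} w = 0"
    then have "\<forall>s\<in>{a..b}. w s = 0"
      using integral_eq_0_iff[OF w] assms(1) by (auto simp: w_def)
    moreover have "(a + b) / 2 \<in> {a..b}" using assms(1) by simp
    ultimately have "w ((a + b) / 2) = 0" by blast
    then show False using assms(1) by (simp add: w_def)
  qed
  define c where "c = integral {a..b} (\<lambda>s. p s * w s) / integral {a..b} w"
  define h where "h s = (p s - c) * w s" for s
  have h: "continuous_on {a..b} h" unfolding h_def by (intro continuous_intros)
  note [continuous_intros] = h
  have "integral {a..b} h = integral {a..b} (\<lambda>s. p s * w s) - c * integral {a..b} w"
    unfolding h_def left_diff_distrib
    by (subst integral_diff)
      (auto intro!: integrable_continuous_interval continuous_intros)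
  then have h0: "integral {a..b} h = 0" using int0 by (simp add: c_def)
  then have ph: "integral {a..b} (\<lambda>s. p s * h s) = 0"
    using orth[OF h _ _ h0] h_def w_def by simp
  have "integral {a..b} (\<lambda>s. (p s - c)\<^sup>2 * w s) = integral {a..b} (\<lambda>s. p s * h s - c * h s)"
    by (rule integral_cong) (simp add: h_def power2_eq_square algebra_simps)
  also have "\<dots> = 0" using ph h0
    by (subst integral_diff)
      (auto intro!: integrable_continuous_interval continuous_intros)
  finally have z: "integral {a..b} (\<lambda>s. (p s - c)\<^sup>2 * w s) = 0" .
  have cont: "continuous_on {a..b} (\<lambda>s. (p s - c)\<^sup>2 * w s)" by (intro continuous_intros)
  have in0: "p s = c" if "s \<in> {a<..<b}" for s
  proof -
    have "(p s - c)\<^sup>2 * w s = 0"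
      using z integral_eq_0_iff[OF cont] assms(1) that by (auto simp: w_def)
    then show ?thesis using that by (auto simp: w_def)
  qed
  have "p s = c" if "s \<in> {a..b}" for s
    by (rule continuous_constant_on_closure[of "{a<..<b}" p c s])
       (use assms(1) p in0 that in auto)
  then show thesis using that by blast
qed

text \<open>
  Stationarity yields the equation for a merely \<open>C\<^sup>1\<close> function \<open>\<theta>\<close>: its derivative turns out to be
  differentiable, up to the end points. Only perturbations that vanish at \<open>a\<close> and \<open>b\<close> are tested.
\<close>

lemma free_stationary_euler_lagrange:
  assumes "a < b" "C2_real V" "free_stationary a b A V \<theta>" "s \<in> {a..b}"
  shows "(deriv_on a b \<theta> has_real_derivative - deriv V (\<theta> s)) (at s within {a..b})"
proof -
  have C1: "C1_interval a b \<theta>" using assms unfolding free_stationary_def by auto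
  note V = C2_real_derivs[OF assms(2)]
  note [continuous_intros] = C1_interval_continuous[OF C1]
  define g where "g s = deriv V (\<theta> s)" for s
  have g: "continuous_on {a..b} g"
    unfolding g_def
    by (rule continuous_on_compose2[OF V(4)[of UNIV] C1_interval_continuous(1)[OF C1]]) auto
  define G where "G s = integral {a..s} g" for s
  have G: "(G has_real_derivative g s) (at s within {a..b})" if "s \<in> {a..b}" for s
    unfolding G_def by (rule integral_has_real_derivative[OF g that])
  have Gc: "continuous_on {a..b} G" using G DERIV_continuous_on by blast
  note [continuous_intros] = g Gc
  define p where "p s = deriv_on a b \<theta> s - A + G s" for s
  have p: "continuous_on {a..b} p" unfolding p_def by (intro continuous_intros)
  have "\<exists>c. \<forall>s\<in>{a..b}. p s = c"
  proof (rule du_Bois_Reymond_vanishing_ends[OF assms(1) p])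
    fix h :: "real \<Rightarrow> real"
    assume h: "continuous_on {a..b} h" "h a = 0" "h b = 0" "integral {a..b} h = 0"
    define \<tau> where "\<tau> s = integral {a..s} h" for s
    have \<tau>: "(\<tau> has_real_derivative h s) (at s within {a..b})" if "s \<in> {a..b}" for s
      unfolding \<tau>_def by (rule integral_has_real_derivative[OF h(1) that])
    have d\<tau>: "deriv_on a b \<tau> s = h s" if "s \<in> {a..b}" for s
      using deriv_on_eqI[OF assms(1) that \<tau>[OF that]] .
    have C1\<tau>: "C1_interval a b \<tau>" using C1_intervalI[OF assms(1) \<tau> h(1)] .
    note [continuous_intros] = h(1) C1_interval_continuous[OF C1\<tau>]
    \<comment> \<open>The zero function is not an admissible perturbation and is treated separately.\<close>
    have "first_variation a b A V \<theta> \<tau> = 0"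
    proof (cases "\<exists>s\<in>{a..b}. \<tau> s \<noteq> 0")
      case True
      then have "\<tau> \<in> free_perturbations a b"
        using C1\<tau> d\<tau> h assms(1) by (simp add: free_perturbations_def)
      then show ?thesis using free_stationary_first_variation assms by blast
    next
      case False
      then have "deriv_on a b \<tau> s = 0" if "s \<in> {a..b}" for s
        using assms(1) that
        by (intro deriv_on_eqI)
          (auto simp: has_real_derivative_iff_has_vector_derivative
            intro: has_vector_derivative_transform[where f = "\<lambda>_. 0"])
      then have "first_variation a b A V \<theta> \<tau> = integral {a..b} (\<lambda>_. 0)"
        unfolding first_variation_def using False by (intro integral_cong) auto
      then show ?thesis by simp
    qed
    moreover have "first_variation a b A V \<theta> \<tau> =
        integral {a..b} (\<lambda>s. p s * h s - (G s * h s + g s * \<tau> s))"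
      unfolding first_variation_def
      by (rule integral_cong) (simp add: d\<tau> p_def g_def algebra_simps)
    moreover have "\<dots> = integral {a..b} (\<lambda>s. p s * h s)
        - integral {a..b} (\<lambda>s. G s * h s + g s * \<tau> s)"
      by (rule integral_diff) (intro integrable_continuous_interval continuous_intros p)+
    \<comment> \<open>The integrand is \<open>(G \<tau>)'\<close>, and \<open>\<tau>\<close> vanishes at both ends.\<close>
    moreover have "((\<lambda>s. G s * h s + g s * \<tau> s) has_integral (G b * \<tau> b - G a * \<tau> a)) {a..b}"
      using assms(1)
      by (intro fundamental_theorem_of_calculus)
        (auto simp: has_real_derivative_iff_has_vector_derivative[symmetric]
          intro!: derivative_eq_intros G \<tau>)
    then have "integral {a..b} (\<lambda>s. G s * h s + g s * \<tau> s) = 0"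
      using h by (simp add: \<tau>_def integral_unique)
    ultimately show "integral {a..b} (\<lambda>s. p s * h s) = 0" by simp
  qed blast
  then obtain c where c: "\<And>s. s \<in> {a..b} \<Longrightarrow> p s = c" by blast
  have eq: "deriv_on a b \<theta> s = c + A - G s" if "s \<in> {a..b}" for s
    using c[OF that] by (simp add: p_def)
  have "((\<lambda>s. c + A - G s) has_real_derivative - g s) (at s within {a..b})"
    using assms(4) by (auto intro!: derivative_eq_intros G)
  then have "(deriv_on a b \<theta> has_real_derivative - g s) (at s within {a..b})"
    unfolding has_real_derivative_iff_has_vector_derivative
    by (rule has_vector_derivative_transform[OF assms(4), rotated]) (rule eq)
  then show ?thesis by (simp add: g_def)
qed

section \<open>The translation mode and its boundary correction\<close>

text \<open>
  With \<open>\<phi> = \<theta>'\<close>, the part of \<open>(\<phi>' + \<eta>')\<^sup>2 - V''(\<theta>) (\<phi> + \<eta>)\<^sup>2\<close> that involves \<open>\<phi>\<close> is the derivative of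
  \<open>\<phi>' (\<phi> + 2 \<eta>)\<close>, by the Jacobi equation; thus \<open>\<phi>\<close> contributes boundary terms only.
\<close>

lemma jacobi_second_variation_add:
  assumes "a < b" "C2_real V" "C1_interval a b \<theta>" "C1_interval a b \<eta>"
    and EL: "\<And>s. s \<in> {a..b} \<Longrightarrow>
      (deriv_on a b \<theta> has_real_derivative - deriv V (\<theta> s)) (at s within {a..b})"
  shows "second_variation a b V \<theta> (\<lambda>s. deriv_on a b \<theta> s + \<eta> s) =
    xi a b V \<theta> a - xi a b V \<theta> b + 2 * (deriv V (\<theta> a) * \<eta> a - deriv V (\<theta> b) * \<eta> b)
    + second_variation a b V \<theta> \<eta>"
proof -
  note V = C2_real_derivs[OF assms(2)]
  define \<phi> where "\<phi> = deriv_on a b \<theta>"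
  define g where "g s = deriv V (\<theta> s)" for s
  define k where "k s = deriv (deriv V) (\<theta> s)" for s
  define \<eta>' where "\<eta>' = deriv_on a b \<eta>"
  have \<theta>: "(\<theta> has_real_derivative \<phi> s) (at s within {a..b})" if "s \<in> {a..b}" for s
    unfolding \<phi>_def using C1_interval_has_derivative[OF assms(3) that] .
  have \<eta>: "(\<eta> has_real_derivative \<eta>' s) (at s within {a..b})" if "s \<in> {a..b}" for s
    unfolding \<eta>'_def using C1_interval_has_derivative[OF assms(4) that] .
  have \<phi>: "(\<phi> has_real_derivative - g s) (at s within {a..b})" if "s \<in> {a..b}" for s
    unfolding \<phi>_def g_def using EL[OF that] .
  have g: "(g has_real_derivative k s * \<phi> s) (at s within {a..b})" if "s \<in> {a..b}" for s
    unfolding g_def k_def using DERIV_chain2[OF V(2) \<theta>[OF that]] .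
  have kc: "continuous_on {a..b} k"
    unfolding k_def
    by (rule continuous_on_compose2[OF V(5)[of UNIV] C1_interval_continuous(1)[OF assms(3)]]) auto
  have \<eta>c: "continuous_on {a..b} \<eta>" "continuous_on {a..b} \<eta>'"
    unfolding \<eta>'_def using C1_interval_continuous[OF assms(4)] by auto
  have d: "deriv_on a b (\<lambda>s. \<phi> s + \<eta> s) s = \<eta>' s - g s" if "s \<in> {a..b}" for s
    using that assms(1) by (intro deriv_on_eqI) (auto intro!: derivative_eq_intros \<phi> \<eta>)
  \<comment> \<open>The derivative of \<open>\<phi>' (\<phi> + 2 \<eta>) = - g (\<phi> + 2 \<eta>)\<close>.\<close>
  let ?J = "\<lambda>s. - (k s * \<phi> s) * (\<phi> s + 2 * \<eta> s) - g s * (- g s + 2 * \<eta>' s)"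
  have J: "(?J has_integral (- g b * (\<phi> b + 2 * \<eta> b) - (- g a * (\<phi> a + 2 * \<eta> a)))) {a..b}"
    using assms(1)
    by (intro fundamental_theorem_of_calculus)
      (auto simp: has_real_derivative_iff_has_vector_derivative[symmetric]
          intro!: derivative_eq_intros g \<phi> \<eta>)
  have Q: "((\<lambda>s. (\<eta>' s)\<^sup>2 - k s * (\<eta> s)\<^sup>2) has_integral second_variation a b V \<theta> \<eta>) {a..b}"
    unfolding second_variation_def \<eta>'_def[symmetric] k_def[symmetric]
    by (intro integrable_integral integrable_continuous_interval continuous_intros \<eta>c kc)
  have "second_variation a b V \<theta> (\<lambda>s. \<phi> s + \<eta> s) =
      integral {a..b} (\<lambda>s. ?J s + ((\<eta>' s)\<^sup>2 - k s * (\<eta> s)\<^sup>2))"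
    unfolding second_variation_def
    by (rule integral_cong) (simp only: d k_def[symmetric] power2_eq_square, simp add: algebra_simps)
  also have "\<dots> = - g b * (\<phi> b + 2 * \<eta> b) - (- g a * (\<phi> a + 2 * \<eta> a)) + second_variation a b V \<theta> \<eta>"
    by (rule integral_unique[OF has_integral_add[OF J Q]])
  also have "\<dots> = xi a b V \<theta> a - xi a b V \<theta> b
      + 2 * (deriv V (\<theta> a) * \<eta> a - deriv V (\<theta> b) * \<eta> b) + second_variation a b V \<theta> \<eta>"
    by (simp add: xi_def g_def \<phi>_def algebra_simps)
  finally show ?thesis by (simp only: \<phi>_def)
qed

lemma has_integral_end_powers:
  assumes "a < (b::real)"
  shows "((\<lambda>s. ((b - s) / (b - a)) ^ m) has_integral (b - a) / (m + 1)) {a..b}"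
    and "((\<lambda>s. ((s - a) / (b - a)) ^ m) has_integral (b - a) / (m + 1)) {a..b}"
proof -
  define l where "l = b - a"
  have l: "l > 0" using assms by (simp add: l_def)
  have "((\<lambda>s. - (l / (m + 1)) * ((b - s) / l) ^ (m + 1)) has_real_derivative ((b - s) / l) ^ m)
      (at s within {a..b})" for s
    using l by (auto intro!: derivative_eq_intros simp del: power_Suc)
  then have "((\<lambda>s. ((b - s) / l) ^ m) has_integral
      (- (l / (m + 1)) * ((b - b) / l) ^ (m + 1) - - (l / (m + 1)) * ((b - a) / l) ^ (m + 1))) {a..b}"
    using assms
    by (intro fundamental_theorem_of_calculus)
      (auto simp only: has_real_derivative_iff_has_vector_derivative less_imp_le)
  then show "((\<lambda>s. ((b - s) / (b - a)) ^ m) has_integral (b - a) / (m + 1)) {a..b}"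
    using l by (simp add: l_def)
  have "((\<lambda>s. l / (m + 1) * ((s - a) / l) ^ (m + 1)) has_real_derivative ((s - a) / l) ^ m)
      (at s within {a..b})" for s
    using l by (auto intro!: derivative_eq_intros simp del: power_Suc)
  then have "((\<lambda>s. ((s - a) / l) ^ m) has_integral
      (l / (m + 1) * ((b - a) / l) ^ (m + 1) - l / (m + 1) * ((a - a) / l) ^ (m + 1))) {a..b}"
    using assms
    by (intro fundamental_theorem_of_calculus)
      (auto simp only: has_real_derivative_iff_has_vector_derivative less_imp_le)
  then show "((\<lambda>s. ((s - a) / (b - a)) ^ m) has_integral (b - a) / (m + 1)) {a..b}"
    using l by (simp add: l_def)
qed

text \<open>
  End slopes \<open>p, q\<close> can be prescribed so cheaply that the cost \<open>Q(\<eta>)\<close> is less than the boundary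
  term \<open>2 (q \<eta>(b) - p \<eta>(a))\<close>. With \<open>l = b - a\<close>, \<open>u(s) = (b - s) / l\<close> and \<open>v(s) = (s - a) / l\<close> the choice is
  \<open>\<eta> = (l / n) (q v\<^sup>n - p u\<^sup>n)\<close>. The boundary term equals \<open>2 (p\<^sup>2 + q\<^sup>2) l / n\<close>. After the cross terms are
  absorbed by \<open>(x + y)\<^sup>2 \<le> 2 x\<^sup>2 + 2 y\<^sup>2\<close>, the gradient term is at most \<open>2 (p\<^sup>2 + q\<^sup>2) l / (2 n - 1)\<close>,
  about half of the boundary term, and the potential term is of order \<open>1 / n\<^sup>3\<close>.
\<close>

lemma second_variation_end_correction:
  assumes "a < b" "C2_real V" "C1_interval a b \<theta>" "p \<noteq> 0 \<or> q \<noteq> 0"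
  obtains \<eta> where "C1_interval a b \<eta>" "deriv_on a b \<eta> a = p" "deriv_on a b \<eta> b = q"
    "second_variation a b V \<theta> \<eta> < 2 * (q * \<eta> b - p * \<eta> a)"
proof -
  note V = C2_real_derivs[OF assms(2)]
  define k where "k s = deriv (deriv V) (\<theta> s)" for s
  have kc: "continuous_on {a..b} k"
    unfolding k_def
    by (rule continuous_on_compose2[OF V(5)[of UNIV] C1_interval_continuous(1)[OF assms(3)]]) auto
  obtain M where M: "\<And>s. s \<in> {a..b} \<Longrightarrow> \<bar>k s\<bar> \<le> M"
    using continuous_on_interval_bounded[OF kc] by blast
  have M0: "M \<ge> 0" using M[of a] assms(1) by force
  define l where "l = b - a"
  have l: "l > 0" using assms by (simp add: l_def)
  \<comment> \<open>\<open>M l\<^sup>2 \<le> m\<close> is what makes the potential term subordinate.\<close>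
  obtain m0 :: nat where m0: "M * l\<^sup>2 \<le> real m0" using real_arch_simple by blast
  define m where "m = max m0 1"
  have m: "M * l\<^sup>2 \<le> real m" "m \<ge> 1" using m0 by (auto simp: m_def)
  \<comment> \<open>As \<open>n \<ge> 2\<close>, each of the two powers has slope zero at the opposite end point.\<close>
  define n where "n = real m + 1"
  have n: "n > 0" by (simp add: n_def)
  define u v where "u s = (b - s) / l" and "v s = (s - a) / l" for s
  define \<eta> where "\<eta> s = l / n * (q * v s ^ Suc m - p * u s ^ Suc m)" for s
  define \<eta>' where "\<eta>' s = q * v s ^ m + p * u s ^ m" for s
  have d: "(\<eta> has_real_derivative \<eta>' s) (at s within {a..b})" for s
    unfolding \<eta>_def \<eta>'_def u_def v_def n_def using l
    by (auto intro!: derivative_eq_intros simp del: power_Suc)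
      (simp add: divide_simps, simp add: algebra_simps)
  have \<eta>'c: "continuous_on {a..b} \<eta>'"
    unfolding \<eta>'_def u_def v_def using l by (intro continuous_intros) auto
  have \<eta>c: "continuous_on {a..b} \<eta>" using d DERIV_continuous_on by blast
  have dd: "deriv_on a b \<eta> s = \<eta>' s" if "s \<in> {a..b}" for s
    using deriv_on_eqI[OF assms(1) that d] .
  have ends: "u a = 1" "u b = 0" "v a = 0" "v b = 1" using l by (auto simp: u_def v_def l_def)
  let ?P = "p\<^sup>2 + q\<^sup>2"
  have P: "?P > 0" using assms(4) by (simp add: sum_power2_gt_zero_iff)
  have iu: "((\<lambda>s. u s ^ j) has_integral l / (real j + 1)) {a..b}"
    and iv: "((\<lambda>s. v s ^ j) has_integral l / (real j + 1)) {a..b}" for j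
    using has_integral_end_powers[OF assms(1), of j] by (auto simp: u_def v_def l_def add.commute)
  \<comment> \<open>A pointwise bound of the integrand of \<open>Q(\<eta>)\<close>, and its integral.\<close>
  define B where "B s = 2 * (p\<^sup>2 * u s ^ (2 * m) + q\<^sup>2 * v s ^ (2 * m))
    + M * ((l / n)\<^sup>2 * (2 * (p\<^sup>2 * u s ^ (2 * Suc m) + q\<^sup>2 * v s ^ (2 * Suc m))))" for s
  define I where "I = 2 * (p\<^sup>2 * (l / (real (2 * m) + 1)) + q\<^sup>2 * (l / (real (2 * m) + 1)))
    + M * ((l / n)\<^sup>2 * (2 * (p\<^sup>2 * (l / (real (2 * Suc m) + 1)) + q\<^sup>2 * (l / (real (2 * Suc m) + 1)))))"
  have BI: "(B has_integral I) {a..b}"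
    unfolding B_def I_def by (intro has_integral_add has_integral_mult_right iu iv)
  have sq: "(x + y)\<^sup>2 \<le> 2 * (y\<^sup>2 + x\<^sup>2)" "(x - y)\<^sup>2 \<le> 2 * (y\<^sup>2 + x\<^sup>2)" for x y :: real
    using zero_le_power2[of "x - y"] zero_le_power2[of "x + y"]
    by (auto simp: power2_eq_square algebra_simps)
  have le: "(\<eta>' s)\<^sup>2 - k s * (\<eta> s)\<^sup>2 \<le> B s" if s: "s \<in> {a..b}" for s
  proof -
    have 1: "(\<eta>' s)\<^sup>2 \<le> 2 * (p\<^sup>2 * u s ^ (2 * m) + q\<^sup>2 * v s ^ (2 * m))"
      using sq(1)[of "q * v s ^ m" "p * u s ^ m"]
      by (simp add: \<eta>'_def power_mult_distrib power_mult[symmetric] mult.commute)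
    have "(q * v s ^ Suc m - p * u s ^ Suc m)\<^sup>2
        \<le> 2 * (p\<^sup>2 * u s ^ (2 * Suc m) + q\<^sup>2 * v s ^ (2 * Suc m))"
      using sq(2)[of "q * v s ^ Suc m" "p * u s ^ Suc m"]
      by (simp only: power_mult_distrib power_mult[symmetric] mult.commute)
    then have 2: "(\<eta> s)\<^sup>2 \<le> (l / n)\<^sup>2 * (2 * (p\<^sup>2 * u s ^ (2 * Suc m) + q\<^sup>2 * v s ^ (2 * Suc m)))"
      unfolding \<eta>_def power_mult_distrib[of "l / n"] by (rule mult_left_mono) simp
    have "- k s * (\<eta> s)\<^sup>2 \<le> M * (\<eta> s)\<^sup>2"
      using M[OF s] by (intro mult_right_mono) auto
    also have "\<dots> \<le> M * ((l / n)\<^sup>2 * (2 * (p\<^sup>2 * u s ^ (2 * Suc m) + q\<^sup>2 * v s ^ (2 * Suc m))))"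
      by (rule mult_left_mono[OF 2 M0])
    finally show ?thesis using 1 unfolding B_def by simp
  qed
  have "second_variation a b V \<theta> \<eta> = integral {a..b} (\<lambda>s. (\<eta>' s)\<^sup>2 - k s * (\<eta> s)\<^sup>2)"
    unfolding second_variation_def by (rule integral_cong) (simp add: dd k_def)
  also have "\<dots> \<le> integral {a..b} B"
    using le
    by (intro integral_le has_integral_integrable[OF BI] integrable_continuous_interval
        continuous_intros \<eta>c \<eta>'c kc)
  also have "\<dots> = I" using BI by (rule integral_unique)
  also have "I = 2 * ?P * l * (1 / (2 * n - 1) + M * l\<^sup>2 / (n\<^sup>2 * (2 * n + 1)))"
  proof -
    have "real (2 * m) + 1 = 2 * n - 1" "real (2 * Suc m) + 1 = 2 * n + 1"
      by (simp_all add: n_def)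
    then show ?thesis
      unfolding I_def by (simp only: divide_inverse power_mult_distrib power_inverse
        inverse_mult_distrib power2_eq_square) (simp only: algebra_simps)
  qed
  also have "\<dots> < 2 * ?P * l * (1 / n)"
  proof (rule mult_strict_left_mono)
    have "M * l\<^sup>2 / (n\<^sup>2 * (2 * n + 1)) < n / (n\<^sup>2 * (2 * n + 1))"
      using m n by (intro divide_strict_right_mono) (auto simp: n_def)
    also have "\<dots> = 1 / (n * (2 * n + 1))" using n by (simp add: power2_eq_square)
    also have "\<dots> \<le> (n - 1) / (n * (2 * n - 1))"
    proof -
      have "n \<ge> 2" using m by (simp add: n_def)
      moreover have "0 \<le> (n - 2) * (n + 0.5)" using \<open>n \<ge> 2\<close> by simp
      then have "2 * n - 1 \<le> (n - 1) * (2 * n + 1)" using \<open>n \<ge> 2\<close> by (simp add: algebra_simps)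
      then have "n * (2 * n - 1) \<le> n * ((n - 1) * (2 * n + 1))" using n by simp
      ultimately show ?thesis by (simp add: divide_simps mult_ac)
    qed
    also have "\<dots> = 1 / n - 1 / (2 * n - 1)"
      using m by (simp add: n_def field_simps)
    finally show "1 / (2 * n - 1) + M * l\<^sup>2 / (n\<^sup>2 * (2 * n + 1)) < 1 / n" by simp
  qed (use P l in simp)
  also have "\<dots> = 2 * (q * \<eta> b - p * \<eta> a)"
    unfolding \<eta>_def ends using n by (simp add: field_simps power2_eq_square)
  finally have "second_variation a b V \<theta> \<eta> < 2 * (q * \<eta> b - p * \<eta> a)" .
  moreover have "deriv_on a b \<eta> a = p" "deriv_on a b \<eta> b = q"
    using dd[of a] dd[of b] assms(1) m(2) by (auto simp: \<eta>'_def ends)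
  ultimately show thesis
    using that C1_intervalI[OF assms(1) d \<eta>'c] by blast
qed

section \<open>Failure of local minimality\<close>

lemma negative_second_variation_not_locally_minimal:
  assumes "a < b" "C2_real V" "free_stationary a b A V \<theta>"
    "C1_interval a b \<tau>" "deriv_on a b \<tau> a = 0" "deriv_on a b \<tau> b = 0"
    "second_variation a b V \<theta> \<tau> < 0"
  shows "\<not> locally_minimal a b A V (free_perturbations a b) \<theta>"
proof
  assume lm: "locally_minimal a b A V (free_perturbations a b) \<theta>"
  let ?Q = "second_variation a b V \<theta> \<tau>"
  have C1: "C1_interval a b \<theta>" using assms unfolding free_stationary_def by auto
  have "\<exists>s\<in>{a..b}. \<tau> s \<noteq> 0"
  proof (rule ccontr)
    assume "\<not> (\<exists>s\<in>{a..b}. \<tau> s \<noteq> 0)"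
    then have "?Q = integral {a..b} (\<lambda>s. (deriv_on a b \<tau> s)\<^sup>2)"
      unfolding second_variation_def by (intro integral_cong) auto
    also have "\<dots> \<ge> 0"
      by (intro integral_nonneg integrable_continuous_interval continuous_intros
        C1_interval_continuous[OF assms(4)]) auto
    finally show False using assms(7) by simp
  qed
  then have \<tau>: "\<tau> \<in> free_perturbations a b"
    using assms by (simp add: free_perturbations_def)
  then obtain M where M: "M > 0" "\<And>\<epsilon>. \<epsilon> \<in> {-M..M} - {0} \<Longrightarrow>
      energy a b A V (\<lambda>s. \<theta> s + \<epsilon> * \<tau> s) > energy a b A V \<theta>"
    using lm unfolding locally_minimal_def by blast
  \<comment> \<open>An error of \<open>- Q \<epsilon>\<^sup>2 / 4\<close> still leaves half of the quadratic term \<open>Q \<epsilon>\<^sup>2 / 2 < 0\<close>.\<close>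
  have "- ?Q / 4 > 0" using assms(7) by simp
  from energy_expansion[OF assms(1,2) C1 assms(4) this]
  obtain d where d: "d > 0" "\<And>\<epsilon>. \<bar>\<epsilon>\<bar> < d \<Longrightarrow>
       \<bar>energy a b A V (\<lambda>s. \<theta> s + \<epsilon> * \<tau> s) - energy a b A V \<theta>
        - \<epsilon> * first_variation a b A V \<theta> \<tau> - \<epsilon>\<^sup>2 / 2 * ?Q\<bar> \<le> - ?Q / 4 * \<epsilon>\<^sup>2"
    by blast
  define \<epsilon> where "\<epsilon> = min M (d / 2)"
  have \<epsilon>: "\<epsilon> \<in> {-M..M} - {0}" "\<bar>\<epsilon>\<bar> < d" using M d by (auto simp: \<epsilon>_def)
  have "energy a b A V (\<lambda>s. \<theta> s + \<epsilon> * \<tau> s) - energy a b A V \<theta> \<le> \<epsilon>\<^sup>2 * ?Q / 4"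
    using d(2)[OF \<epsilon>(2)] free_stationary_first_variation[OF assms(1-3) \<tau>]
    by (auto simp: abs_le_iff algebra_simps)
  also have "\<dots> \<le> 0" using assms(7) by (simp add: mult_nonneg_nonpos)
  finally show False using M(2)[OF \<epsilon>(1)] by simp
qed

theorem theorem4:
  fixes a b A \<beta> :: real and V \<theta> :: "real \<Rightarrow> real"
  assumes "a < b"
    and "C2_real V"
    and "\<And>x. \<not> (deriv V x = 0 \<and> deriv (deriv V) x = 0)"
    and "free_stationary a b A V \<theta>"
    and "deriv V (\<theta> a) \<noteq> 0" and "deriv V (\<theta> b) \<noteq> 0"
    and "\<beta> = xi a b V \<theta> a - xi a b V \<theta> b"
    and "\<beta> \<le> 0"
  shows "\<not> locally_minimal a b A V (free_perturbations a b) \<theta>"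
proof -
  have C1: "C1_interval a b \<theta>" using assms(4) unfolding free_stationary_def by auto
  note EL = free_stationary_euler_lagrange[OF assms(1,2,4)]
  have cont: "continuous_on {a..b} (\<lambda>s. - deriv V (\<theta> s))"
    by (intro continuous_on_minus continuous_on_compose2[OF C2_real_derivs(4)[OF assms(2), of UNIV]
        C1_interval_continuous(1)[OF C1]]) auto
  obtain \<eta> where \<eta>: "C1_interval a b \<eta>" "deriv_on a b \<eta> a = deriv V (\<theta> a)"
    "deriv_on a b \<eta> b = deriv V (\<theta> b)"
    "second_variation a b V \<theta> \<eta> < 2 * (deriv V (\<theta> b) * \<eta> b - deriv V (\<theta> a) * \<eta> a)"
    using second_variation_end_correction[OF assms(1,2) C1] assms(5) by metis
  define \<tau> where "\<tau> s = deriv_on a b \<theta> s + \<eta> s" for s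
  have d: "(\<tau> has_real_derivative - deriv V (\<theta> s) + deriv_on a b \<eta> s) (at s within {a..b})"
    if "s \<in> {a..b}" for s
    unfolding \<tau>_def by (intro DERIV_add EL C1_interval_has_derivative[OF \<eta>(1)] that)
  have "C1_interval a b \<tau>"
    using C1_intervalI[OF assms(1) d]
      continuous_on_add[OF cont C1_interval_continuous(2)[OF \<eta>(1)]] by blast
  moreover have "deriv_on a b \<tau> a = 0" "deriv_on a b \<tau> b = 0"
    using deriv_on_eqI[OF assms(1) _ d] assms(1) \<eta>(2,3) by auto
  moreover have "second_variation a b V \<theta> \<tau> < 0"
    using jacobi_second_variation_add[OF assms(1,2) C1 \<eta>(1) EL] \<eta>(4) assms(7,8)
    by (simp add: \<tau>_def[abs_def])
  ultimately show ?thesis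
    using negative_second_variation_not_locally_minimal assms by blast
qed

end
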